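(* Let $\mathcal{S}=((X,d),(f_i)_{i\in I})$ be an iterated function system consisting of convex contractions on a nonempty complete metric space $(X,d)$, with $I$ finite and nonempty. Then: (i) There exists a unique $A\in\mathcal{K}(X)$ such that $\lim_{n\to\infty}h(F_{\mathcal{S}}^{[n]}(B),A)=0$ for every $B\in\mathcal{K}(X)$. (ii) For each $\omega\in\Lambda(I)$ there exists $a_\omega\in X$ such that $\lim_{n\to\infty}h(f_{[\omega]_n}(B),\{a_\omega\})=0$ for every $B\in\mathcal{K}(X)$. Moreover, $\lim_{n\to\infty}\sup_{\omega\in\Lambda(I)}h(f_{[\omega]_n}(B),\{a_\omega\})=0$ for every $B\in\mathcal{K}(X)$. (iii) With $A$ as in (i) and $a_\omega$ as in (ii), $A=\overline{\{a_\omega\mid\omega\in\Lambda(I)\}}$. (iv) For every sequence $(Y_n)_{n\in\mathbb{N}}\subseteq\mathcal{K}(X)$ and every $Y\in\mathcal{K}(X)$, if $\lim_{n\to\infty}h(Y_n,Y)=0$, then $\lim_{n\to\infty}h(F_{\mathcal{S}}(Y_n),F_{\mathcal{S}}(Y))=0$. (v) The set $A$ from (i) is the unique fixed point of $F_{\mathcal{S}}:\mathcal{K}(X)\to\mathcal{K}(X)$.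
   Context: $\mathcal{K}(X)$ is the set of nonempty compact subsets of $X$. For nonempty $A,B\subseteq X$, the Hausdorff-Pompeiu distance is $h(A,B)=\max(d(A,B),d(B,A))$, where $d(A,B)=\sup_{x\in A}\inf_{y\in B}d(x,y)$. An iterated function system consisting of convex contractions on a complete metric space $(X,d)$, denoted $\mathcal{S}=((X,d),(f_i)_{i\in I})$, is given by a finite family of continuous functions $f_i:X\to X$, $i\in I$, such that for every $i,j\in I$ there exist $a_{ij},b_{ij},c_{ij}\in[0,\infty)$ with the following two properties: ($\alpha$) $d_{ij}:=a_{ij}+b_{ij}+c_{ij}$ satisfies $\max_{i,j\in I}d_{ij}=:d<1$; ($\beta$) $d((f_i\circ f_j)(x),(f_i\circ f_j)(y))\le a_{ij}\,d(x,y)+b_{ij}\,d(f_i(x),f_i(y))+c_{ij}\,d(f_j(x),f_j(y))$ for every $i,j\in I$ and all $x,y\in X$. The associated function $F_{\mathcal{S}}:\mathcal{K}(X)\to\mathcal{K}(X)$ is $F_{\mathcal{S}}(B)=\bigcup_{i\in I}f_i(B)$, and $F_{\mathcal{S}}^{[n]}$ denotes its $n$-fold composition with itself. $\Lambda(I)=I^{\{1,2,3,\dots\}}$ is the set of infinite words $\omega=\omega_1\omega_2\omega_3\dots$ with letters in $I$. For $n\ge1$, $[\omega]_n=\omega_1\omega_2\dots\omega_n$, and $f_{\omega_1\omega_2\dots\omega_n}=f_{\omega_1}\circ f_{\omega_2}\circ\dots\circ f_{\omega_n}$. *)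

theory Defs
  imports "HOL-Analysis.Analysis"
begin

text \<open>The complete metric space \<open>X\<close> is a type of class \<open>complete_space\<close>
  (nonempty, as every type is); the index set is a set \<open>I\<close> over an arbitrary type.\<close>

definition nonempty_compacts :: "'a::metric_space set set" ("\<K>")
  where "\<K> = {K. K \<noteq> {} \<and> compact K}"

text \<open>Values in \<open>[0, \<infinity>]\<close>, so that all suprema, in particular those over
  unbounded sets, have their mathematical meaning (real-valued \<open>SUP\<close> is unspecified there).\<close>

definition excess :: "'a::metric_space set \<Rightarrow> 'a set \<Rightarrow> ennreal"
  where "excess A B = (SUP x\<in>A. INF y\<in>B. ennreal (dist x y))"

definition hausdorff_dist :: "'a::metric_space set \<Rightarrow> 'a set \<Rightarrow> ennreal"
  where "hausdorff_dist A B = max (excess A B) (excess B A)"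

text \<open>Nonemptiness of \<open>I\<close> is not included; for \<open>I = {}\<close> the \<open>Max\<close> below is unspecified.\<close>

definition convex_contraction_ifs :: "'i set \<Rightarrow> ('i \<Rightarrow> 'a::metric_space \<Rightarrow> 'a) \<Rightarrow> bool"
  where "convex_contraction_ifs I f \<longleftrightarrow>
    finite I \<and>
    (\<forall>i\<in>I. continuous_on UNIV (f i)) \<and>
    (\<exists>a b c :: 'i \<Rightarrow> 'i \<Rightarrow> real.
      (\<forall>i\<in>I. \<forall>j\<in>I. 0 \<le> a i j \<and> 0 \<le> b i j \<and> 0 \<le> c i j) \<and>
      Max ((\<lambda>(i, j). a i j + b i j + c i j) ` (I \<times> I)) < 1 \<and>
      (\<forall>i\<in>I. \<forall>j\<in>I. \<forall>x y.
        dist ((f i \<circ> f j) x) ((f i \<circ> f j) y)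
          \<le> a i j * dist x y + b i j * dist (f i x) (f i y) + c i j * dist (f j x) (f j y)))"

definition ifs_operator :: "'i set \<Rightarrow> ('i \<Rightarrow> 'a \<Rightarrow> 'a) \<Rightarrow> 'a set \<Rightarrow> 'a set"
  where "ifs_operator I f B = (\<Union>i\<in>I. f i ` B)"

lemma ifs_operator_in_nonempty_compacts:
  assumes "convex_contraction_ifs I f" "I \<noteq> {}" "B \<in> \<K>"
  shows "ifs_operator I f B \<in> \<K>"
  using assms
  by (auto simp: ifs_operator_def nonempty_compacts_def convex_contraction_ifs_def
      intro!: compact_UN compact_continuous_image intro: continuous_on_subset)

definition infinite_words :: "'i set \<Rightarrow> (nat \<Rightarrow> 'i) set" ("\<Lambda>")
  where "\<Lambda> I = ({1..} \<rightarrow>\<^sub>E I)"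

definition word_prefix :: "(nat \<Rightarrow> 'i) \<Rightarrow> nat \<Rightarrow> 'i list"
  where "word_prefix \<omega> n = map \<omega> [1..<Suc n]"

definition word_map :: "('i \<Rightarrow> 'a \<Rightarrow> 'a) \<Rightarrow> 'i list \<Rightarrow> 'a \<Rightarrow> 'a"
  where "word_map f w = foldr (\<lambda>i g. f i \<circ> g) w id"

definition attractor :: "'i set \<Rightarrow> ('i \<Rightarrow> 'a::metric_space \<Rightarrow> 'a) \<Rightarrow> 'a set \<Rightarrow> bool"
  where "attractor I f A \<longleftrightarrow> A \<in> \<K> \<and>
    (\<forall>B\<in>\<K>. (\<lambda>n. hausdorff_dist ((ifs_operator I f ^^ n) B) A) \<longlonglongrightarrow> 0)"

text \<open>\<open>address_point f \<omega> x\<close>: the point \<open>x\<close> has the property defining \<open>a\<^sub>\<omega>\<close>.\<close>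

definition address_point :: "('i \<Rightarrow> 'a::metric_space \<Rightarrow> 'a) \<Rightarrow> (nat \<Rightarrow> 'i) \<Rightarrow> 'a \<Rightarrow> bool"
  where "address_point f \<omega> x \<longleftrightarrow>
    (\<forall>B\<in>\<K>. (\<lambda>n. hausdorff_dist (word_map f (word_prefix \<omega> n) ` B) {x}) \<longlonglongrightarrow> 0)"

end

theory Submission
  imports Defs
begin

text \<open>
  Everything follows from one estimate on finite words.  Writing \<open>D\<^sub>n(x, y)\<close> for the largest
  distance between \<open>f\<^sub>w x\<close> and \<open>f\<^sub>w y\<close> over words \<open>w\<close> of length \<open>n\<close>, the convex contraction
  inequality applied to the two leftmost letters of a word reads
  \<open>D\<^sub>n\<^sub>+\<^sub>2 \<le> d \<cdot> max (D\<^sub>n, D\<^sub>n\<^sub>+\<^sub>1)\<close>.  Hence \<open>D\<^sub>n(x, y) \<le> q\<^sup>n \<cdot> G(x, y)\<close> as soon as \<open>d \<le> q\<^sup>2 < 1\<close>,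
  where \<open>G\<close> is built from the distances for words of length at most 1 and is therefore continuous,
  so bounded on compact sets (lemma \<open>convex_contraction_ifs_geometric\<close>).

  The locale \<open>geometric_ifs\<close> retains only this geometric decay.  There the points \<open>f\<^bsub>[\<omega>]\<^sub>n\<^esub> x\<close>
  converge to a point \<open>a\<^sub>\<omega>\<close> independent of \<open>x\<close>, at a geometric rate that is uniform in \<open>\<omega>\<close> and in
  \<open>x\<close> from a compact set (lemma \<open>address_rate\<close>).  As the \<open>n\<close>-th iterate of the operator at \<open>B\<close> is
  the union of the sets \<open>f\<^bsub>[\<omega>]\<^sub>n\<^esub> B\<close>, it tends to the closure of the set of all \<open>a\<^sub>\<omega>\<close>; that closure
  is compact because it is approximated arbitrarily well by the finite iterates of a singleton.
  Continuity of the operator comes from continuity of the maps, which is uniform near a compact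
  set; it makes the limit of the iterates a fixed point.  All uniqueness claims come down to
  the uniqueness of Hausdorff limits among closed sets.
\<close>

section \<open>Hausdorff convergence\<close>

lemma hausdorff_dist_commute: "hausdorff_dist A B = hausdorff_dist B A"
  by (simp add: hausdorff_dist_def max.commute)

lemma excess_le:
  assumes "\<And>x. x \<in> A \<Longrightarrow> \<exists>y\<in>B. dist x y \<le> e"
  shows "excess A B \<le> ennreal e"
  unfolding excess_def
proof (rule SUP_least)
  fix x assume "x \<in> A"
  then obtain y where "y \<in> B" "dist x y \<le> e" using assms by blast
  then show "(INF y\<in>B. ennreal (dist x y)) \<le> ennreal e"
    by (intro INF_lower2[of y]) (auto simp: ennreal_leI)
qed

lemma hausdorff_dist_le:
  assumes "\<And>x. x \<in> A \<Longrightarrow> \<exists>y\<in>B. dist x y \<le> e"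
    and "\<And>y. y \<in> B \<Longrightarrow> \<exists>x\<in>A. dist x y \<le> e"
  shows "hausdorff_dist A B \<le> ennreal e"
  using excess_le[of A B e] excess_le[of B A e] assms
  by (simp add: hausdorff_dist_def dist_commute)

lemma hausdorff_dist_lessD:
  assumes "hausdorff_dist A B < ennreal e" "x \<in> A"
  shows "\<exists>y\<in>B. dist x y < e"
proof -
  have "(INF y\<in>B. ennreal (dist x y)) \<le> excess A B"
    unfolding excess_def using assms(2) by (rule SUP_upper)
  also have "\<dots> \<le> hausdorff_dist A B" by (simp add: hausdorff_dist_def)
  also note assms(1)
  finally obtain y where "y \<in> B" "ennreal (dist x y) < ennreal e"
    by (auto simp: INF_less_iff)
  then show ?thesis by (auto simp: ennreal_less_iff)
qed

lemma ennreal_tendsto_0I: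
  fixes u :: "nat \<Rightarrow> ennreal"
  assumes "\<And>e::real. 0 < e \<Longrightarrow> eventually (\<lambda>n. u n \<le> ennreal e) sequentially"
  shows "u \<longlonglongrightarrow> 0"
proof (rule order_tendstoI)
  fix b :: ennreal assume "0 < b"
  then obtain c where c: "0 < c" "c < b" using dense by blast
  then obtain e where e: "c = ennreal e" "0 \<le> e"
    by (cases c) auto
  have "0 < e" using c(1) e by (simp add: ennreal_less_zero_iff)
  from assms[OF this] show "eventually (\<lambda>n. u n < b) sequentially"
    by eventually_elim (use c e in auto)
qed simp

lemma ennreal_tendsto_0_geometric:
  fixes u :: "nat \<Rightarrow> ennreal"
  assumes "\<And>n. u n \<le> ennreal (C * q ^ n)" "0 < q" "q < 1"
  shows "u \<longlonglongrightarrow> 0"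
proof -
  have "(\<lambda>n. C * q ^ n) \<longlonglongrightarrow> C * 0"
    using assms by (intro tendsto_intros LIMSEQ_power_zero) auto
  then have "(\<lambda>n. ennreal (C * q ^ n)) \<longlonglongrightarrow> ennreal 0"
    by (intro tendsto_ennrealI) simp
  then have *: "(\<lambda>n. ennreal (C * q ^ n)) \<longlonglongrightarrow> 0" by simp
  show ?thesis
    by (rule tendsto_sandwich[OF _ _ tendsto_const *]) (use assms(1) in auto)
qed

lemma hausdorff_limit_subset:
  assumes A: "(\<lambda>n. hausdorff_dist (K n) A) \<longlonglongrightarrow> 0"
    and B: "(\<lambda>n. hausdorff_dist (K n) B) \<longlonglongrightarrow> 0"
    and "closed B"
  shows "A \<subseteq> B"
proof
  fix x assume "x \<in> A"
  have "\<exists>y\<in>B. dist y x < e" if "0 < e" for e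
  proof -
    have pos: "0 < ennreal (e/2)" using that by simp
    have "eventually (\<lambda>n. hausdorff_dist (K n) A < ennreal (e/2) \<and>
            hausdorff_dist (K n) B < ennreal (e/2)) sequentially"
      using order_tendstoD(2)[OF A pos] order_tendstoD(2)[OF B pos] by eventually_elim simp
    then obtain n where n: "hausdorff_dist A (K n) < ennreal (e/2)"
        "hausdorff_dist (K n) B < ennreal (e/2)"
      by (auto simp: eventually_sequentially hausdorff_dist_commute)
    obtain z where z: "z \<in> K n" "dist x z < e/2"
      using hausdorff_dist_lessD[OF n(1) \<open>x \<in> A\<close>] by blast
    obtain y where y: "y \<in> B" "dist z y < e/2"
      using hausdorff_dist_lessD[OF n(2) z(1)] by blast
    show ?thesis
      using y z dist_triangle[of x y z] by (intro bexI[of _ y]) (auto simp: dist_commute)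
  qed
  then have "x \<in> closure B" by (simp add: closure_approachable)
  then show "x \<in> B" using \<open>closed B\<close> by simp
qed

lemma hausdorff_limit_unique:
  assumes "(\<lambda>n. hausdorff_dist (K n) A) \<longlonglongrightarrow> 0" "(\<lambda>n. hausdorff_dist (K n) B) \<longlonglongrightarrow> 0"
    and "closed A" "closed B"
  shows "A = B"
  using hausdorff_limit_subset assms by (metis subset_antisym)

lemma nonempty_compacts_closed: "K \<in> \<K> \<Longrightarrow> closed K"
  by (auto simp: nonempty_compacts_def compact_imp_closed)

lemma attractor_unique: "attractor I f A \<Longrightarrow> attractor I f B \<Longrightarrow> A = B"
  by (rule hausdorff_limit_unique[of "\<lambda>n. (ifs_operator I f ^^ n) A"])
    (auto simp: attractor_def nonempty_compacts_closed)

lemma address_point_unique: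
  assumes "address_point f \<omega> x" "address_point f \<omega> y"
  shows "x = y"
proof -
  have "{x} \<in> \<K>" by (simp add: nonempty_compacts_def)
  with assms have "{x} = {y}"
    unfolding address_point_def by (intro hausdorff_limit_unique) auto
  then show ?thesis by simp
qed

text \<open>Uniform continuity on the compact set alone would not do for Hausdorff convergence to it:
  the approximating sets lie outside.  A Lebesgue number of the cover of \<open>K\<close> by preimages of small
  balls controls all points near \<open>K\<close>.\<close>

lemma continuous_uniform_near_compact:
  fixes g :: "'a::metric_space \<Rightarrow> 'b::metric_space"
  assumes "compact K" "continuous_on UNIV g" "0 < e"
  obtains d where "0 < d" "\<And>x y. y \<in> K \<Longrightarrow> dist y x < d \<Longrightarrow> dist (g y) (g x) < e"
proof -
  let ?C = "range (\<lambda>c. g -` ball c (e/2))"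
  have cover: "K \<subseteq> \<Union>?C"
  proof
    fix x assume "x \<in> K"
    have "x \<in> g -` ball (g x) (e/2)" using \<open>0 < e\<close> by simp
    then show "x \<in> \<Union>?C" by blast
  qed
  have op: "open U" if "U \<in> ?C" for U
    using that assms(2) by (auto intro!: open_vimage)
  obtain d where d: "0 < d" "\<And>x. x \<in> K \<Longrightarrow> \<exists>U\<in>?C. ball x d \<subseteq> U"
    using Heine_Borel_lemma[OF assms(1) cover op] by metis
  show ?thesis
  proof (rule that[OF d(1)])
    fix x y assume "y \<in> K" "dist y x < d"
    then obtain c where c: "ball y d \<subseteq> g -` ball c (e/2)" using d(2) by blast
    have "x \<in> ball y d" "y \<in> ball y d" using \<open>dist y x < d\<close> d(1) by auto
    then have "x \<in> g -` ball c (e/2)" "y \<in> g -` ball c (e/2)" using c by blast+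
    then have "dist c (g x) < e/2" "dist c (g y) < e/2" by auto
    then show "dist (g y) (g x) < e"
      using dist_triangle3[of "g y" "g x" c] by linarith
  qed
qed

lemma hausdorff_tendsto_image:
  assumes "compact Z" "continuous_on UNIV g" "(\<lambda>n. hausdorff_dist (Y n) Z) \<longlonglongrightarrow> 0"
  shows "(\<lambda>n. hausdorff_dist (g ` Y n) (g ` Z)) \<longlonglongrightarrow> 0"
proof (rule ennreal_tendsto_0I)
  fix e :: real assume "0 < e"
  obtain d where d: "0 < d" "\<And>x y. y \<in> Z \<Longrightarrow> dist y x < d \<Longrightarrow> dist (g y) (g x) < e"
    using continuous_uniform_near_compact[OF assms(1,2) \<open>0 < e\<close>] by blast
  have "eventually (\<lambda>n. hausdorff_dist (Y n) Z < ennreal d) sequentially"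
    using order_tendstoD(2)[OF assms(3)] d(1) by simp
  then show "eventually (\<lambda>n. hausdorff_dist (g ` Y n) (g ` Z) \<le> ennreal e) sequentially"
  proof eventually_elim
    case (elim n)
    have l: "\<exists>y\<in>Z. dist x y < d" if "x \<in> Y n" for x
      using hausdorff_dist_lessD[OF elim that] .
    have r: "\<exists>x\<in>Y n. dist y x < d" if "y \<in> Z" for y
      using hausdorff_dist_lessD[of Z "Y n" d y] elim that by (simp add: hausdorff_dist_commute)
    show ?case
    proof (rule hausdorff_dist_le)
      fix u assume "u \<in> g ` Y n"
      then obtain x where x: "x \<in> Y n" "u = g x" by blast
      with l obtain y where y: "y \<in> Z" "dist y x < d" by (metis dist_commute)
      then show "\<exists>v\<in>g ` Z. dist u v \<le> e"
        using d(2)[OF y] x by (intro bexI[of _ "g y"]) (auto simp: dist_commute)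
    next
      fix v assume "v \<in> g ` Z"
      then obtain y where y: "y \<in> Z" "v = g y" by blast
      with r obtain x where x: "x \<in> Y n" "dist y x < d" by blast
      then show "\<exists>u\<in>g ` Y n. dist u v \<le> e"
        using d(2)[OF y(1) x(2)] y by (intro bexI[of _ "g x"]) (auto simp: dist_commute)
    qed
  qed
qed

lemma hausdorff_dist_UN_le:
  "hausdorff_dist (\<Union>i\<in>I. A i) (\<Union>i\<in>I. B i) \<le> (SUP i\<in>I. hausdorff_dist (A i) (B i))"
proof -
  have "excess (\<Union>i\<in>I. A i) (\<Union>i\<in>I. B i) \<le> (SUP i\<in>I. hausdorff_dist (A i) (B i))"
    for A B :: "'b \<Rightarrow> 'a set"
    unfolding excess_def
  proof (rule SUP_least)
    fix x assume "x \<in> (\<Union>i\<in>I. A i)"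
    then obtain i where i: "i \<in> I" "x \<in> A i" by blast
    have "(INF y\<in>(\<Union>i\<in>I. B i). ennreal (dist x y)) \<le> (INF y\<in>B i. ennreal (dist x y))"
      using i by (intro INF_superset_mono) auto
    also have "\<dots> \<le> excess (A i) (B i)"
      unfolding excess_def using i by (intro SUP_upper)
    also have "\<dots> \<le> hausdorff_dist (A i) (B i)" by (simp add: hausdorff_dist_def)
    also have "\<dots> \<le> (SUP i\<in>I. hausdorff_dist (A i) (B i))" using i by (intro SUP_upper)
    finally show "(INF y\<in>(\<Union>i\<in>I. B i). ennreal (dist x y)) \<le> (SUP i\<in>I. hausdorff_dist (A i) (B i))" .
  qed
  from this[of A B] this[of B A] show ?thesis
    by (simp add: hausdorff_dist_def max.commute)
qed

text \<open>Finiteness of \<open>I\<close> makes the convergences of the finitely many images simultaneous.\<close>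

lemma hausdorff_tendsto_ifs_operator:
  assumes "finite I" "\<And>i. i \<in> I \<Longrightarrow> continuous_on UNIV (f i)"
    and "compact Z" "(\<lambda>n. hausdorff_dist (Y n) Z) \<longlonglongrightarrow> 0"
  shows "(\<lambda>n. hausdorff_dist (ifs_operator I f (Y n)) (ifs_operator I f Z)) \<longlonglongrightarrow> 0"
proof (rule ennreal_tendsto_0I)
  fix e :: real assume "0 < e"
  have "eventually (\<lambda>n. hausdorff_dist (f i ` Y n) (f i ` Z) < ennreal e) sequentially"
    if "i \<in> I" for i
    using order_tendstoD(2)[OF hausdorff_tendsto_image[OF assms(3) assms(2)[OF that] assms(4)]]
      \<open>0 < e\<close> by simp
  then have "eventually (\<lambda>n. \<forall>i\<in>I. hausdorff_dist (f i ` Y n) (f i ` Z) < ennreal e) sequentially"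
    using assms(1) by (simp add: eventually_ball_finite)
  then show "eventually (\<lambda>n. hausdorff_dist (ifs_operator I f (Y n)) (ifs_operator I f Z)
      \<le> ennreal e) sequentially"
  proof eventually_elim
    case (elim n)
    have "hausdorff_dist (ifs_operator I f (Y n)) (ifs_operator I f Z)
        \<le> (SUP i\<in>I. hausdorff_dist (f i ` Y n) (f i ` Z))"
      unfolding ifs_operator_def by (rule hausdorff_dist_UN_le)
    also have "\<dots> \<le> ennreal e" using elim by (intro SUP_least) (auto intro: less_imp_le)
    finally show ?case .
  qed
qed

section \<open>Words\<close>

lemma word_map_simps [simp]:
  "word_map f [] = id" "word_map f (i # w) = f i \<circ> word_map f w"
  by (simp_all add: word_map_def)

lemma word_map_append: "word_map f (u @ v) = word_map f u \<circ> word_map f v"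
  by (induction u) auto

lemma length_word_prefix [simp]: "length (word_prefix \<omega> n) = n"
  by (simp add: word_prefix_def)

lemma nth_word_prefix: "k < n \<Longrightarrow> word_prefix \<omega> n ! k = \<omega> (Suc k)"
  by (simp add: word_prefix_def del: upt_Suc)

lemma word_prefix_Suc: "word_prefix \<omega> (Suc n) = word_prefix \<omega> n @ [\<omega> (Suc n)]"
  by (simp add: word_prefix_def)

lemma infinite_words_letter: "\<omega> \<in> \<Lambda> I \<Longrightarrow> 1 \<le> k \<Longrightarrow> \<omega> k \<in> I"
  by (auto simp: infinite_words_def)

lemma set_word_prefix: "\<omega> \<in> \<Lambda> I \<Longrightarrow> set (word_prefix \<omega> n) \<subseteq> I"
  by (auto simp: word_prefix_def infinite_words_letter)

lemma word_extends_to_infinite_word: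
  assumes "set w \<subseteq> I" "I \<noteq> {}"
  obtains \<omega> where "\<omega> \<in> \<Lambda> I" "word_prefix \<omega> (length w) = w"
proof -
  obtain i where "i \<in> I" using assms(2) by blast
  \<comment> \<open>Letters of an infinite word are numbered from 1, and the value at 0 is the default one.\<close>
  define \<omega> where "\<omega> = (\<lambda>k\<in>{1..}. if k \<le> length w then w ! (k - 1) else i)"
  have "\<omega> k \<in> I" if "1 \<le> k" for k
  proof (cases "k \<le> length w")
    case True
    then have "w ! (k - 1) \<in> set w" using that by (intro nth_mem) simp
    then show ?thesis using True that assms(1) by (auto simp: \<omega>_def)
  qed (use that \<open>i \<in> I\<close> in \<open>auto simp: \<omega>_def\<close>)
  then have "\<omega> \<in> \<Lambda> I"
    unfolding infinite_words_def by (intro PiE_I) (auto simp: \<omega>_def)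
  moreover have "word_prefix \<omega> (length w) = w"
    by (rule nth_equalityI) (auto simp: \<omega>_def nth_word_prefix)
  ultimately show ?thesis by (rule that)
qed

lemma ifs_operator_power_words:
  "(ifs_operator I f ^^ n) B = (\<Union>w\<in>{w. set w \<subseteq> I \<and> length w = n}. word_map f w ` B)"
proof (induction n)
  case 0
  have "{w. set w \<subseteq> I \<and> length w = 0} = {[]}" by auto
  then show ?case by simp
next
  case (Suc n)
  have words: "{w. set w \<subseteq> I \<and> length w = Suc n}
      = (\<Union>i\<in>I. (#) i ` {w. set w \<subseteq> I \<and> length w = n})"
    by (auto simp: length_Suc_conv image_iff)
  have "(ifs_operator I f ^^ Suc n) B = ifs_operator I f ((ifs_operator I f ^^ n) B)"
    by simp
  also have "\<dots> = (\<Union>w\<in>{w. set w \<subseteq> I \<and> length w = Suc n}. word_map f w ` B)"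
    unfolding Suc.IH words ifs_operator_def by (auto simp: image_iff)
  finally show ?case .
qed

lemma ifs_operator_power:
  assumes "I \<noteq> {}"
  shows "(ifs_operator I f ^^ n) B = (\<Union>\<omega>\<in>\<Lambda> I. word_map f (word_prefix \<omega> n) ` B)"
proof -
  have "{w. set w \<subseteq> I \<and> length w = n} = (\<lambda>\<omega>. word_prefix \<omega> n) ` \<Lambda> I"
  proof (intro equalityI subsetI)
    fix w assume "w \<in> {w. set w \<subseteq> I \<and> length w = n}"
    then have w: "set w \<subseteq> I" "length w = n" by auto
    obtain \<omega> where "\<omega> \<in> \<Lambda> I" "word_prefix \<omega> (length w) = w"
      using word_extends_to_infinite_word[OF w(1) assms] .
    with w(2) show "w \<in> (\<lambda>\<omega>. word_prefix \<omega> n) ` \<Lambda> I" by (metis imageI)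
  qed (auto dest: set_word_prefix)
  then show ?thesis by (simp add: ifs_operator_power_words)
qed

section \<open>Systems with geometric decay along words\<close>

lemma geometric_steps_converge:
  fixes s :: "nat \<Rightarrow> 'a::complete_space"
  assumes step: "\<And>n. dist (s n) (s (Suc n)) \<le> M * q ^ n" and q: "0 < q" "q < 1"
  obtains l where "s \<longlonglongrightarrow> l" "\<And>n. dist (s n) l \<le> M / (1 - q) * q ^ n"
proof -
  have M: "0 \<le> M" using order_trans[OF zero_le_dist step[of 0]] by simp
  have "dist (s n) (s (n + k)) \<le> M / (1 - q) * (q ^ n - q ^ (n + k))" for n k
  proof (induction k)
    case (Suc k)
    have "dist (s n) (s (n + Suc k)) \<le> dist (s n) (s (n + k)) + dist (s (n + k)) (s (Suc (n + k)))"
      using dist_triangle by simp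
    also have "\<dots> \<le> M / (1 - q) * (q ^ n - q ^ (n + k)) + M * q ^ (n + k)"
      using Suc step[of "n + k"] by simp
    also have "\<dots> = M / (1 - q) * (q ^ n - q ^ (n + Suc k))"
      using q by (simp add: field_simps)
    finally show ?case .
  qed simp
  moreover have "M / (1 - q) * (q ^ n - q ^ (n + k)) \<le> M / (1 - q) * q ^ n" for n k
    using M q by (intro mult_left_mono) auto
  ultimately have tail: "dist (s n) (s (n + k)) \<le> M / (1 - q) * q ^ n" for n k
    using order_trans by blast
  have "Cauchy s"
  proof (rule metric_CauchyI)
    fix e :: real assume "0 < e"
    have "(\<lambda>n. M / (1 - q) * q ^ n) \<longlonglongrightarrow> M / (1 - q) * 0"
      using q by (intro tendsto_intros LIMSEQ_power_zero) auto
    then have "eventually (\<lambda>n. M / (1 - q) * q ^ n < e / 2) sequentially"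
      using \<open>0 < e\<close> by (intro order_tendstoD(2)) auto
    then obtain N where N: "M / (1 - q) * q ^ N < e / 2"
      by (auto simp: eventually_sequentially)
    have near: "dist (s N) (s m) < e / 2" if "N \<le> m" for m
      using le_less_trans[OF tail[of N "m - N"] N] that by simp
    show "\<exists>N. \<forall>m\<ge>N. \<forall>n\<ge>N. dist (s m) (s n) < e"
    proof (intro exI allI impI)
      fix m n assume "N \<le> m" "N \<le> n"
      then show "dist (s m) (s n) < e"
        using near[of m] near[of n] dist_triangle3[of "s m" "s n" "s N"] by linarith
    qed
  qed
  then obtain l where l: "s \<longlonglongrightarrow> l" using convergent_eq_Cauchy by blast
  have "dist (s n) l \<le> M / (1 - q) * q ^ n" for n
  proof (rule tendsto_upperbound)
    show "(\<lambda>k. dist (s n) (s (k + n))) \<longlonglongrightarrow> dist (s n) l"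
      by (intro tendsto_intros LIMSEQ_ignore_initial_segment l)
    show "\<forall>\<^sub>F k in sequentially. dist (s n) (s (k + n)) \<le> M / (1 - q) * q ^ n"
      using tail[of n] by (simp add: add.commute)
  qed simp
  with l show ?thesis by (rule that)
qed

text \<open>The maps themselves may expand distances: for a convex contraction \<open>G(x, y)\<close> also measures
  how far one application of the maps can separate \<open>x\<close> and \<open>y\<close>, so it is in general not a multiple of the distance.
  Its continuity is what bounds it on compact sets.\<close>

locale geometric_ifs =
  fixes I :: "'i set" and f :: "'i \<Rightarrow> 'a::complete_space \<Rightarrow> 'a"
    and q :: real and G :: "'a \<Rightarrow> 'a \<Rightarrow> real"
  assumes finite_index: "finite I" and index_nonempty: "I \<noteq> {}"
    and continuous: "\<And>i. i \<in> I \<Longrightarrow> continuous_on UNIV (f i)"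
    and q_pos: "0 < q" and q_less_1: "q < 1"
    and continuous_G: "continuous_on UNIV (\<lambda>(x, y). G x y)"
    and word_decay: "\<And>w x y. set w \<subseteq> I \<Longrightarrow>
      dist (word_map f w x) (word_map f w y) \<le> q ^ length w * G x y"
begin

lemma prefix_decay:
  "\<omega> \<in> \<Lambda> I \<Longrightarrow>
    dist (word_map f (word_prefix \<omega> n) x) (word_map f (word_prefix \<omega> n) y) \<le> q ^ n * G x y"
  using word_decay[OF set_word_prefix, of \<omega> n x y] by simp

lemma prefix_orbits_merge:
  assumes "\<omega> \<in> \<Lambda> I" "(\<lambda>n. word_map f (word_prefix \<omega> n) x) \<longlonglongrightarrow> l"
  shows "(\<lambda>n. word_map f (word_prefix \<omega> n) y) \<longlonglongrightarrow> l"
proof -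
  let ?p = "\<lambda>n. word_map f (word_prefix \<omega> n)"
  have "(\<lambda>n. q ^ n * G x y + dist (?p n x) l) \<longlonglongrightarrow> 0 * G x y + 0"
    using q_pos q_less_1 assms(2)[unfolded tendsto_dist_iff[of _ l]]
    by (intro tendsto_intros LIMSEQ_power_zero) auto
  then have lim: "(\<lambda>n. q ^ n * G x y + dist (?p n x) l) \<longlonglongrightarrow> 0" by simp
  have "dist (?p n y) l \<le> q ^ n * G x y + dist (?p n x) l" for n
    using prefix_decay[OF assms(1), of n x y] dist_triangle[of "?p n y" l "?p n x"]
    by (simp add: dist_commute)
  then have "(\<lambda>n. dist (?p n y) l) \<longlonglongrightarrow> 0"
    by (intro tendsto_sandwich[OF _ _ tendsto_const lim] always_eventually) auto
  then show ?thesis using tendsto_dist_iff by blast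
qed

text \<open>Passing from \<open>[\<omega>]\<^sub>n\<close> to \<open>[\<omega>]\<^sub>n\<^sub>+\<^sub>1\<close> replaces the innermost argument \<open>x\<close> by \<open>f\<^sub>i x\<close>, so
  consecutive orbit points are compared by the decay of \<open>f\<^bsub>[\<omega>]\<^sub>n\<^esub>\<close> between two points of a compact set
  that does not depend on \<open>\<omega>\<close>.\<close>

lemma prefix_orbits_converge_uniformly:
  assumes "compact B"
  obtains C where "0 < C"
    "\<And>\<omega> x. \<omega> \<in> \<Lambda> I \<Longrightarrow> x \<in> B \<Longrightarrow>
      \<exists>l. (\<lambda>n. word_map f (word_prefix \<omega> n) x) \<longlonglongrightarrow> l \<and>
        (\<forall>n. dist (word_map f (word_prefix \<omega> n) x) l \<le> C * q ^ n)"
proof -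
  define K where "K = B \<times> (\<Union>i\<in>I. f i ` B)"
  have "compact K"
    unfolding K_def using assms finite_index continuous
    by (auto intro!: compact_Times compact_UN compact_continuous_image intro: continuous_on_subset)
  then have "compact ((\<lambda>(x, y). G x y) ` K)"
    by (intro compact_continuous_image continuous_on_subset[OF continuous_G]) auto
  then have "bounded ((\<lambda>(x, y). G x y) ` K)" by (rule compact_imp_bounded)
  then obtain M where M: "0 < M" "\<forall>t\<in>(\<lambda>(x, y). G x y) ` K. norm t \<le> M"
    unfolding bounded_pos by blast
  show ?thesis
  proof (rule that)
    show "0 < M / (1 - q)" using M(1) q_less_1 by simp
    fix \<omega> x assume \<omega>: "\<omega> \<in> \<Lambda> I" and x: "x \<in> B"
    have "dist (word_map f (word_prefix \<omega> n) x) (word_map f (word_prefix \<omega> (Suc n)) x) \<le> M * q ^ n"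
      for n
    proof -
      have "(x, f (\<omega> (Suc n)) x) \<in> K"
        using x infinite_words_letter[OF \<omega>] by (auto simp: K_def)
      then have "norm (G x (f (\<omega> (Suc n)) x)) \<le> M" using M(2) by (metis imageI case_prod_conv)
      then have "G x (f (\<omega> (Suc n)) x) \<le> M" by simp
      then have "q ^ n * G x (f (\<omega> (Suc n)) x) \<le> M * q ^ n"
        using q_pos by (simp add: mult.commute)
      moreover have "word_map f (word_prefix \<omega> (Suc n)) x
          = word_map f (word_prefix \<omega> n) (f (\<omega> (Suc n)) x)"
        by (simp add: word_prefix_Suc word_map_append)
      ultimately show ?thesis using prefix_decay[OF \<omega>, of n x "f (\<omega> (Suc n)) x"] by simp
    qed
    from geometric_steps_converge[OF this q_pos q_less_1]
    show "\<exists>l. (\<lambda>n. word_map f (word_prefix \<omega> n) x) \<longlonglongrightarrow> l \<and>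
        (\<forall>n. dist (word_map f (word_prefix \<omega> n) x) l \<le> M / (1 - q) * q ^ n)"
      by metis
  qed
qed

text \<open>The choice of the starting point is immaterial by lemma \<open>prefix_orbits_merge\<close>.\<close>

definition address :: "(nat \<Rightarrow> 'i) \<Rightarrow> 'a"
  where "address \<omega> = lim (\<lambda>n. word_map f (word_prefix \<omega> n) undefined)"

lemma address_limit:
  assumes "\<omega> \<in> \<Lambda> I"
  shows "(\<lambda>n. word_map f (word_prefix \<omega> n) x) \<longlonglongrightarrow> address \<omega>"
proof -
  obtain l where "(\<lambda>n. word_map f (word_prefix \<omega> n) undefined) \<longlonglongrightarrow> l"
    using prefix_orbits_converge_uniformly[of "{undefined}"] assms by (metis compact_sing singletonI)
  then have "(\<lambda>n. word_map f (word_prefix \<omega> n) undefined) \<longlonglongrightarrow> address \<omega>"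
    unfolding address_def by (metis limI)
  then show ?thesis by (rule prefix_orbits_merge[OF assms])
qed

lemma address_rate:
  assumes "compact B"
  shows "\<exists>C>0. \<forall>\<omega>\<in>\<Lambda> I. \<forall>x\<in>B. \<forall>n.
    dist (word_map f (word_prefix \<omega> n) x) (address \<omega>) \<le> C * q ^ n"
proof (rule prefix_orbits_converge_uniformly[OF assms])
  fix C assume "0 < C" and orbits: "\<And>\<omega> x. \<omega> \<in> \<Lambda> I \<Longrightarrow> x \<in> B \<Longrightarrow>
      \<exists>l. (\<lambda>n. word_map f (word_prefix \<omega> n) x) \<longlonglongrightarrow> l \<and>
        (\<forall>n. dist (word_map f (word_prefix \<omega> n) x) l \<le> C * q ^ n)"
  have "dist (word_map f (word_prefix \<omega> n) x) (address \<omega>) \<le> C * q ^ n"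
    if "\<omega> \<in> \<Lambda> I" "x \<in> B" for \<omega> x n
    using orbits[OF that] LIMSEQ_unique[OF address_limit[OF that(1)]] by blast
  with \<open>0 < C\<close> show ?thesis by blast
qed

lemma address_hausdorff_rate:
  assumes "B \<in> \<K>"
  shows "\<exists>C. \<forall>\<omega>\<in>\<Lambda> I. \<forall>n.
    hausdorff_dist (word_map f (word_prefix \<omega> n) ` B) {address \<omega>} \<le> ennreal (C * q ^ n)"
proof -
  have B: "compact B" "B \<noteq> {}" using assms by (auto simp: nonempty_compacts_def)
  obtain C where C: "\<forall>\<omega>\<in>\<Lambda> I. \<forall>x\<in>B. \<forall>n.
      dist (word_map f (word_prefix \<omega> n) x) (address \<omega>) \<le> C * q ^ n"
    using address_rate[OF B(1)] by blast
  have "hausdorff_dist (word_map f (word_prefix \<omega> n) ` B) {address \<omega>} \<le> ennreal (C * q ^ n)"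
    if "\<omega> \<in> \<Lambda> I" for \<omega> n
    using that B(2) C by (intro hausdorff_dist_le) auto
  then show ?thesis by blast
qed

lemma address_point_address:
  assumes "\<omega> \<in> \<Lambda> I"
  shows "address_point f \<omega> (address \<omega>)"
  unfolding address_point_def
proof
  fix B :: "'a set" assume B: "B \<in> \<K>"
  obtain C where "\<forall>\<omega>\<in>\<Lambda> I. \<forall>n.
      hausdorff_dist (word_map f (word_prefix \<omega> n) ` B) {address \<omega>} \<le> ennreal (C * q ^ n)"
    using address_hausdorff_rate[OF B] by blast
  from this[rule_format, OF assms] show "(\<lambda>n. hausdorff_dist (word_map f (word_prefix \<omega> n) ` B) {address \<omega>}) \<longlonglongrightarrow> 0"
    by (rule ennreal_tendsto_0_geometric[OF _ q_pos q_less_1])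
qed

lemma address_uniform:
  assumes "B \<in> \<K>"
  shows "(\<lambda>n. SUP \<omega>\<in>\<Lambda> I. hausdorff_dist (word_map f (word_prefix \<omega> n) ` B) {address \<omega>}) \<longlonglongrightarrow> 0"
proof -
  obtain C where "\<forall>\<omega>\<in>\<Lambda> I. \<forall>n.
    hausdorff_dist (word_map f (word_prefix \<omega> n) ` B) {address \<omega>} \<le> ennreal (C * q ^ n)"
    using address_hausdorff_rate[OF assms] by blast
  then have "(SUP \<omega>\<in>\<Lambda> I. hausdorff_dist (word_map f (word_prefix \<omega> n) ` B) {address \<omega>})
      \<le> ennreal (C * q ^ n)" for n
    by (simp add: SUP_least)
  then show ?thesis by (rule ennreal_tendsto_0_geometric[OF _ q_pos q_less_1])
qed

lemma infinite_words_nonempty: "\<Lambda> I \<noteq> {}"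
  using word_extends_to_infinite_word[of "[]" I] index_nonempty by auto

text \<open>The factor 2 below pays for the closure, whose points are only approximated by addresses.\<close>

lemma iterates_tendsto_address_closure:
  assumes "B \<in> \<K>"
  shows "(\<lambda>n. hausdorff_dist ((ifs_operator I f ^^ n) B) (closure (address ` \<Lambda> I))) \<longlonglongrightarrow> 0"
proof -
  let ?A = "closure (address ` \<Lambda> I)"
  have "compact B" using assms by (simp add: nonempty_compacts_def)
  obtain b where b: "b \<in> B" using assms by (auto simp: nonempty_compacts_def)
  obtain C where C: "0 < C" and rate: "\<forall>\<omega>\<in>\<Lambda> I. \<forall>x\<in>B. \<forall>n.
      dist (word_map f (word_prefix \<omega> n) x) (address \<omega>) \<le> C * q ^ n"
    using address_rate[OF \<open>compact B\<close>] by blast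
  have pos: "0 < C * q ^ n" for n using C q_pos by simp
  have "hausdorff_dist ((ifs_operator I f ^^ n) B) ?A \<le> ennreal (2 * C * q ^ n)" for n
  proof (rule hausdorff_dist_le)
    fix x assume "x \<in> (ifs_operator I f ^^ n) B"
    then obtain \<omega> u where \<omega>: "\<omega> \<in> \<Lambda> I" "u \<in> B" "x = word_map f (word_prefix \<omega> n) u"
      by (auto simp: ifs_operator_power[OF index_nonempty])
    have "address \<omega> \<in> ?A"
      using \<omega>(1) by (intro subsetD[OF closure_subset] imageI)
    moreover have "dist x (address \<omega>) \<le> 2 * C * q ^ n"
      using rate[rule_format, OF \<omega>(1,2), of n] \<omega>(3) pos[of n] by simp
    ultimately show "\<exists>y\<in>?A. dist x y \<le> 2 * C * q ^ n" by (rule bexI[rotated])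
  next
    fix y assume y: "y \<in> ?A"
    obtain \<omega> where \<omega>: "\<omega> \<in> \<Lambda> I" "dist (address \<omega>) y < C * q ^ n"
      using y pos[of n] unfolding closure_approachable by blast
    let ?x = "word_map f (word_prefix \<omega> n) b"
    have "?x \<in> (ifs_operator I f ^^ n) B"
      using \<omega>(1) b by (auto simp: ifs_operator_power[OF index_nonempty])
    moreover have "dist ?x y \<le> 2 * C * q ^ n"
      using dist_triangle[of ?x y "address \<omega>"] rate[rule_format, OF \<omega>(1) b, of n] \<omega>(2) by simp
    ultimately show "\<exists>x\<in>(ifs_operator I f ^^ n) B. dist x y \<le> 2 * C * q ^ n"
      by (rule bexI[rotated])
  qed
  then show ?thesis by (rule ennreal_tendsto_0_geometric[OF _ q_pos q_less_1])
qed

text \<open>The iterates of a singleton are finite sets that come arbitrarily close to the closure of the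
  addresses, which is therefore totally bounded.\<close>

lemma address_closure_in_nonempty_compacts: "closure (address ` \<Lambda> I) \<in> \<K>"
proof -
  let ?A = "closure (address ` \<Lambda> I)"
  have "\<exists>k. finite k \<and> ?A \<subseteq> (\<Union>x\<in>k. ball x e)" if "0 < e" for e
  proof -
    have "{undefined} \<in> \<K>" by (simp add: nonempty_compacts_def)
    from order_tendstoD(2)[OF iterates_tendsto_address_closure[OF this], of "ennreal e"] that
    obtain n where n: "hausdorff_dist ?A ((ifs_operator I f ^^ n) {undefined}) < ennreal e"
      by (auto simp: eventually_sequentially hausdorff_dist_commute)
    let ?k = "(ifs_operator I f ^^ n) {undefined}"
    have "finite ?k"
      using finite_lists_length_eq[OF finite_index] by (simp add: ifs_operator_power_words)
    moreover have "?A \<subseteq> (\<Union>x\<in>?k. ball x e)"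
    proof
      fix y assume "y \<in> ?A"
      from hausdorff_dist_lessD[OF n this] show "y \<in> (\<Union>x\<in>?k. ball x e)"
        by (simp add: dist_commute)
    qed
    ultimately show ?thesis by (intro exI conjI)
  qed
  then have "compact ?A" by (simp add: compact_eq_totally_bounded complete_eq_closed)
  then show ?thesis using infinite_words_nonempty by (simp add: nonempty_compacts_def)
qed

lemma attractor_address_closure: "attractor I f (closure (address ` \<Lambda> I))"
  using address_closure_in_nonempty_compacts iterates_tendsto_address_closure
  by (simp add: attractor_def)

text \<open>The iterates of \<open>A\<close> tend to \<open>A\<close>, and, after one more application of the continuous operator,
  also to the image of \<open>A\<close>.\<close>

lemma attractor_fixed:
  assumes "attractor I f A"
  shows "ifs_operator I f A = A"
proof -
  have A: "A \<in> \<K>" "compact A" and lim: "(\<lambda>n. hausdorff_dist ((ifs_operator I f ^^ n) A) A) \<longlonglongrightarrow> 0"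
    using assms by (auto simp: attractor_def nonempty_compacts_def)
  have "compact (ifs_operator I f A)"
    unfolding ifs_operator_def using A finite_index continuous
    by (auto intro!: compact_UN compact_continuous_image intro: continuous_on_subset)
  moreover have "(\<lambda>n. hausdorff_dist ((ifs_operator I f ^^ Suc n) A) (ifs_operator I f A)) \<longlonglongrightarrow> 0"
    using hausdorff_tendsto_ifs_operator[OF finite_index continuous A(2) lim] by simp
  ultimately show ?thesis
    using hausdorff_limit_unique[OF _ LIMSEQ_Suc[OF lim]] A(2) by (blast intro: compact_imp_closed)
qed

end

lemma fixed_compact_eq_attractor:
  assumes "attractor I f A" "B \<in> \<K>" "ifs_operator I f B = B"
  shows "B = A"
proof -
  have "(ifs_operator I f ^^ n) B = B" for n by (induction n) (use assms(3) in auto)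
  then have "(\<lambda>n::nat. hausdorff_dist B A) \<longlonglongrightarrow> 0"
    using assms(1,2) by (auto simp: attractor_def)
  moreover have "(\<lambda>n::nat. hausdorff_dist B B) \<longlonglongrightarrow> 0"
    using hausdorff_dist_le[of B B 0] by (auto intro: tendsto_eq_intros)
  ultimately show ?thesis
    using hausdorff_limit_unique[of "\<lambda>_. B" B A] assms(1,2)
    by (auto simp: attractor_def nonempty_compacts_closed)
qed

section \<open>Convex contractions\<close>

text \<open>For a word \<open>i j w\<close> the convex contraction inequality at \<open>f\<^sub>w x\<close>, \<open>f\<^sub>w y\<close> bounds the distance
  by a combination, of total weight at most \<open>r\<close>, of the distances for the shorter words \<open>w\<close>, \<open>i w\<close>
  and \<open>j w\<close>.  Only two letters at a time gain a factor \<open>r\<close>, which is why the rate must satisfy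
  \<open>r \<le> q\<^sup>2\<close>; the division by \<open>q\<close> in the last factor makes the bound true for one letter.\<close>

lemma convex_contraction_word_decay:
  fixes f :: "'i \<Rightarrow> 'a::metric_space \<Rightarrow> 'a"
  assumes "finite I"
    and nonneg: "\<And>i j. i \<in> I \<Longrightarrow> j \<in> I \<Longrightarrow> 0 \<le> a i j \<and> 0 \<le> b i j \<and> 0 \<le> c i j"
    and weight: "\<And>i j. i \<in> I \<Longrightarrow> j \<in> I \<Longrightarrow> a i j + b i j + c i j \<le> r"
    and contr: "\<And>i j x y. i \<in> I \<Longrightarrow> j \<in> I \<Longrightarrow> dist (f i (f j x)) (f i (f j y))
      \<le> a i j * dist x y + b i j * dist (f i x) (f i y) + c i j * dist (f j x) (f j y)"
    and q: "0 < q" "q < 1" "r \<le> q\<^sup>2"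
    and "set w \<subseteq> I"
  shows "dist (word_map f w x) (word_map f w y)
    \<le> q ^ length w * ((dist x y + (\<Sum>i\<in>I. dist (f i x) (f i y))) / q)"
  using \<open>set w \<subseteq> I\<close>
proof (induction w rule: length_induct)
  case (1 w)
  let ?S = "\<Sum>i\<in>I. dist (f i x) (f i y)"
  define G where "G = (dist x y + ?S) / q"
  have S: "0 \<le> ?S" by (simp add: sum_nonneg)
  have G: "0 \<le> G" using q S by (simp add: G_def)
  have IH: "dist (word_map f v x) (word_map f v y) \<le> q ^ length v * G"
    if "length v < length w" "set v \<subseteq> I" for v
    using 1 that by (auto simp: G_def)
  consider "w = []" | i where "w = [i]" | i j v where "w = i # j # v"
    by (metis list.exhaust)
  then have "dist (word_map f w x) (word_map f w y) \<le> q ^ length w * G"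
  proof cases
    assume w: "w = []"
    have "dist x y * q \<le> dist x y + ?S"
      using mult_left_mono[of q 1 "dist x y"] q S by simp
    then show ?thesis using w q by (simp add: G_def pos_le_divide_eq)
  next
    fix i assume w: "w = [i]"
    have "dist (f i x) (f i y) \<le> ?S"
      using w 1(2) assms(1) by (intro member_le_sum) auto
    then show ?thesis using w q by (simp add: G_def add_increasing)
  next
    fix i j v assume w: "w = i # j # v"
    then have I: "i \<in> I" "j \<in> I" "set v \<subseteq> I" using 1(2) by auto
    let ?x = "word_map f v x" and ?y = "word_map f v y" and ?E = "q ^ length v * G"
    have E: "0 \<le> ?E" using q G by simp
    have shorter: "q * ?E \<le> ?E" using q E by (simp add: mult_left_le_one_le)
    have "dist ?x ?y \<le> ?E" using IH[of v] I w by simp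
    moreover have "dist (f i ?x) (f i ?y) \<le> ?E"
      using IH[of "i # v"] I w shorter by simp
    moreover have "dist (f j ?x) (f j ?y) \<le> ?E"
      using IH[of "j # v"] I w shorter by simp
    ultimately have "a i j * dist ?x ?y + b i j * dist (f i ?x) (f i ?y) + c i j * dist (f j ?x) (f j ?y)
        \<le> a i j * ?E + b i j * ?E + c i j * ?E"
      using nonneg[OF I(1,2)] by (intro add_mono mult_left_mono) auto
    also have "\<dots> = (a i j + b i j + c i j) * ?E" by (simp add: algebra_simps)
    also have "\<dots> \<le> q\<^sup>2 * ?E"
      using weight[OF I(1,2)] q(3) E by (intro mult_right_mono) auto
    also have "\<dots> = q ^ length w * G" using w by (simp add: power2_eq_square)
    finally show ?thesis using contr[OF I(1,2), of ?x ?y] w by simp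
  qed
  then show ?case by (simp add: G_def)
qed

lemma convex_contraction_ifs_geometric:
  fixes f :: "'i \<Rightarrow> 'a::complete_space \<Rightarrow> 'a"
  assumes "convex_contraction_ifs I f" "I \<noteq> {}"
  obtains q G where "geometric_ifs I f q G"
proof -
  have fin: "finite I" and cont: "\<And>i. i \<in> I \<Longrightarrow> continuous_on UNIV (f i)"
    using assms(1) by (auto simp: convex_contraction_ifs_def)
  obtain a b c :: "'i \<Rightarrow> 'i \<Rightarrow> real" where
    coeffs: "\<forall>i\<in>I. \<forall>j\<in>I. 0 \<le> a i j \<and> 0 \<le> b i j \<and> 0 \<le> c i j"
    and less: "Max ((\<lambda>(i, j). a i j + b i j + c i j) ` (I \<times> I)) < 1"
    and convex: "\<forall>i\<in>I. \<forall>j\<in>I. \<forall>x y. dist ((f i \<circ> f j) x) ((f i \<circ> f j) y)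
      \<le> a i j * dist x y + b i j * dist (f i x) (f i y) + c i j * dist (f j x) (f j y)"
    using assms(1) unfolding convex_contraction_ifs_def by (elim conjE exE)
  have nonneg: "0 \<le> a i j \<and> 0 \<le> b i j \<and> 0 \<le> c i j" if "i \<in> I" "j \<in> I" for i j
    using coeffs that by blast
  have contr: "dist (f i (f j x)) (f i (f j y))
      \<le> a i j * dist x y + b i j * dist (f i x) (f i y) + c i j * dist (f j x) (f j y)"
    if "i \<in> I" "j \<in> I" for i j x y
    using convex that by simp
  define r where "r = Max ((\<lambda>(i, j). a i j + b i j + c i j) ` (I \<times> I))"
  have weight: "a i j + b i j + c i j \<le> r" if "i \<in> I" "j \<in> I" for i j
    unfolding r_def using fin that by (intro Max_ge) auto
  obtain i where "i \<in> I" using assms(2) by blast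
  then have r: "0 \<le> r" "r < 1" using weight[of i i] nonneg[of i i] less by (auto simp: r_def)
  \<comment> \<open>The arithmetic mean of 1 and \<open>r\<close> dominates their geometric mean, so \<open>r \<le> q\<^sup>2\<close>;
    unlike the square root of \<open>r\<close> it is positive also for \<open>r = 0\<close>.\<close>
  define q where "q = (1 + r) / 2"
  have "q\<^sup>2 - r = ((1 - r) / 2)\<^sup>2" by (simp add: q_def power2_eq_square field_simps)
  then have "r \<le> q\<^sup>2" using zero_le_power2[of "(1 - r) / 2"] by linarith
  then have q: "0 < q" "q < 1" "r \<le> q\<^sup>2" using r by (auto simp: q_def)
  let ?G = "\<lambda>x y. (dist x y + (\<Sum>i\<in>I. dist (f i x) (f i y))) / q"
  have "continuous_on UNIV (\<lambda>z. f i (fst z))" "continuous_on UNIV (\<lambda>z. f i (snd z))"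
    if "i \<in> I" for i
    by (rule continuous_on_compose2[OF cont[OF that]]; simp add: continuous_intros)+
  then have "continuous_on UNIV (\<lambda>z. ?G (fst z) (snd z))"
    using q(1) by (intro continuous_intros) auto
  then have "continuous_on UNIV (\<lambda>(x, y). ?G x y)" by (simp add: case_prod_beta)
  moreover have "dist (word_map f w x) (word_map f w y) \<le> q ^ length w * ?G x y"
    if "set w \<subseteq> I" for w x y
    by (rule convex_contraction_word_decay[OF fin nonneg weight contr q that])
  ultimately have "geometric_ifs I f q ?G"
    using fin assms(2) cont q(1,2) by (intro geometric_ifs.intro)
  then show ?thesis by (rule that)
qed

section \<open>The attractor and its addresses\<close>

theorem theorem3p2:
  fixes I :: "'i set" and f :: "'i \<Rightarrow> 'a::complete_space \<Rightarrow> 'a"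
  assumes "convex_contraction_ifs I f" and "I \<noteq> {}"
  shows
    "(\<exists>!A. attractor I f A) \<and>
     (\<forall>\<omega>\<in>\<Lambda> I. \<exists>x. address_point f \<omega> x) \<and>
     (\<forall>a. (\<forall>\<omega>\<in>\<Lambda> I. address_point f \<omega> (a \<omega>)) \<longrightarrow>
        (\<forall>B\<in>\<K>. (\<lambda>n. SUP \<omega>\<in>\<Lambda> I. hausdorff_dist (word_map f (word_prefix \<omega> n) ` B) {a \<omega>})
          \<longlonglongrightarrow> 0)) \<and>
     (\<forall>A a. attractor I f A \<and> (\<forall>\<omega>\<in>\<Lambda> I. address_point f \<omega> (a \<omega>)) \<longrightarrow>
        A = closure {a \<omega> | \<omega>. \<omega> \<in> \<Lambda> I}) \<and>
     (\<forall>Y Z. (\<forall>n. Y n \<in> \<K>) \<and> Z \<in> \<K> \<and> (\<lambda>n. hausdorff_dist (Y n) Z) \<longlonglongrightarrow> 0 \<longrightarrow>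
        (\<lambda>n. hausdorff_dist (ifs_operator I f (Y n)) (ifs_operator I f Z)) \<longlonglongrightarrow> 0) \<and>
     (\<forall>A. attractor I f A \<longrightarrow>
        ifs_operator I f A = A \<and> (\<forall>B\<in>\<K>. ifs_operator I f B = B \<longrightarrow> B = A))"
proof -
  obtain q G where "geometric_ifs I f q G"
    using convex_contraction_ifs_geometric[OF assms] .
  then interpret geometric_ifs I f q G .
  have addresses: "a \<omega> = address \<omega>"
    if "\<forall>\<omega>\<in>\<Lambda> I. address_point f \<omega> (a \<omega>)" "\<omega> \<in> \<Lambda> I" for a \<omega>
    using that address_point_address address_point_unique by blast
  show ?thesis
  proof (intro conjI)
    show "\<exists>!A. attractor I f A"
      using attractor_address_closure attractor_unique by blast
    show "\<forall>\<omega>\<in>\<Lambda> I. \<exists>x. address_point f \<omega> x"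
      using address_point_address by blast
    show "\<forall>a. (\<forall>\<omega>\<in>\<Lambda> I. address_point f \<omega> (a \<omega>)) \<longrightarrow>
        (\<forall>B\<in>\<K>. (\<lambda>n. SUP \<omega>\<in>\<Lambda> I. hausdorff_dist (word_map f (word_prefix \<omega> n) ` B) {a \<omega>})
          \<longlonglongrightarrow> 0)"
    proof (intro allI impI ballI)
      fix a and B :: "'a set"
      assume a: "\<forall>\<omega>\<in>\<Lambda> I. address_point f \<omega> (a \<omega>)" and B: "B \<in> \<K>"
      have "(SUP \<omega>\<in>\<Lambda> I. hausdorff_dist (word_map f (word_prefix \<omega> n) ` B) {a \<omega>})
          = (SUP \<omega>\<in>\<Lambda> I. hausdorff_dist (word_map f (word_prefix \<omega> n) ` B) {address \<omega>})" for n
        by (rule SUP_cong) (simp_all add: addresses[OF a])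
      then show "(\<lambda>n. SUP \<omega>\<in>\<Lambda> I. hausdorff_dist (word_map f (word_prefix \<omega> n) ` B) {a \<omega>})
          \<longlonglongrightarrow> 0"
        using address_uniform[OF B] by simp
    qed
    show "\<forall>A a. attractor I f A \<and> (\<forall>\<omega>\<in>\<Lambda> I. address_point f \<omega> (a \<omega>)) \<longrightarrow>
        A = closure {a \<omega> | \<omega>. \<omega> \<in> \<Lambda> I}"
    proof (intro allI impI, elim conjE)
      fix A a assume A: "attractor I f A" and a: "\<forall>\<omega>\<in>\<Lambda> I. address_point f \<omega> (a \<omega>)"
      have "{a \<omega> | \<omega>. \<omega> \<in> \<Lambda> I} = a ` \<Lambda> I" by (rule Setcompr_eq_image)
      also have "\<dots> = address ` \<Lambda> I" by (rule image_cong) (simp_all add: addresses[OF a])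
      finally show "A = closure {a \<omega> | \<omega>. \<omega> \<in> \<Lambda> I}"
        using attractor_unique[OF A attractor_address_closure] by simp
    qed
    show "\<forall>Y Z. (\<forall>n. Y n \<in> \<K>) \<and> Z \<in> \<K> \<and> (\<lambda>n. hausdorff_dist (Y n) Z) \<longlonglongrightarrow> 0 \<longrightarrow>
        (\<lambda>n. hausdorff_dist (ifs_operator I f (Y n)) (ifs_operator I f Z)) \<longlonglongrightarrow> 0"
      using hausdorff_tendsto_ifs_operator[OF finite_index continuous]
      by (auto simp: nonempty_compacts_def)
    show "\<forall>A. attractor I f A \<longrightarrow>
        ifs_operator I f A = A \<and> (\<forall>B\<in>\<K>. ifs_operator I f B = B \<longrightarrow> B = A)"
      using attractor_fixed fixed_compact_eq_attractor by blast
  qed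
qed

end
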